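(* Finding a nested orientation in the dynamic-LOCAL model requires locality $\omega(1)$; that is, there is no dynamic-LOCAL algorithm that finds a nested orientation in all graphs with constant locality.
   Context: Graphs are simple, undirected, finite; $B(v,T)$ is the set of nodes within distance $T$ of $v$. Nested orientation: let $G=(V,E)$ with unique identifiers $f\colon V\to\{1,\dots,\mathrm{poly}(|V|)\}$ (part of the input). A nested orientation $(O,h)$ consists of an acyclic orientation $O$ of the edges and a labeling $h$ of the nodes with $h(v)=(f(v),F(v),H(v))$, where $F(v)=\{f(u):\{v,u\}\in E\}$ and $H(v)=\{h(u):(u,v)\in O\}$ is the set of labels of the in-neighbors of $v$ under $O$. Dynamic-LOCAL model with locality $T$: computation starts from the empty graph $G_0$; in step $i$ the adversary builds a supergraph $G_i$ of $G_{i-1}$ differing from it in exactly one node or one edge. Let $C_i$ be the set of nodes $v$ of $G_i$ with $G_i[B(v,T)]\ne G_{i-1}[B(v,T)]$. After each step the algorithm must output a feasible solution $L_i$ for $G_i$ with $L_i(v)=L_{i-1}(v)$ for all $v\notin C_i$. *)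

theory Defs
  imports Complex_Main "HOL-Library.FSet" "HOL-Library.FuncSet" "HOL-Library.Landau_Symbols"
begin

text \<open>
  Finite simple undirected graphs with node identifiers. Nodes are taken from the infinite
  type \<^typ>\<open>nat\<close>; the identifier \<open>ident G v\<close> is part of the input and independent of the name
  of \<open>v\<close>. Identifiers are extensional (undefined off the node set), so that equality of
  records is equality of graphs together with their inputs.
\<close>

record igraph =
  verts :: "nat set"
  edges :: "nat set set"
  ident :: "nat \<Rightarrow> nat"

definition empty_igraph :: igraph where
  "empty_igraph = \<lparr>verts = {}, edges = {}, ident = (\<lambda>v. undefined)\<rparr>"

definition valid_igraph :: "(nat \<Rightarrow> nat) \<Rightarrow> igraph \<Rightarrow> bool" where
  "valid_igraph p G \<longleftrightarrow>
     finite (verts G) \<and>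
     (\<forall>e\<in>edges G. e \<subseteq> verts G \<and> card e = 2) \<and>
     ident G \<in> verts G \<rightarrow>\<^sub>E {1..p (card (verts G))} \<and>
     inj_on (ident G) (verts G)"

definition adj :: "igraph \<Rightarrow> (nat \<times> nat) set" where
  "adj G = {(u, v). {u, v} \<in> edges G}"

text \<open>If \<open>v\<close> is not a node of a valid graph \<open>G\<close>, then the ball around \<open>v\<close> is empty.\<close>

definition gball :: "igraph \<Rightarrow> nat \<Rightarrow> nat \<Rightarrow> nat set" where
  "gball G v T = {u \<in> verts G. \<exists>k\<le>T. (v, u) \<in> adj G ^^ k}"

definition induced :: "igraph \<Rightarrow> nat set \<Rightarrow> igraph" where
  "induced G S = \<lparr>verts = verts G \<inter> S, edges = {e \<in> edges G. e \<subseteq> S},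
                  ident = restrict (ident G) (verts G \<inter> S)\<rparr>"

definition supergraph :: "igraph \<Rightarrow> igraph \<Rightarrow> bool" where
  "supergraph G' G \<longleftrightarrow>
     verts G \<subseteq> verts G' \<and> edges G \<subseteq> edges G' \<and> (\<forall>v\<in>verts G. ident G' v = ident G v)"

definition adversary_step :: "igraph \<Rightarrow> igraph \<Rightarrow> bool" where
  "adversary_step G G' \<longleftrightarrow>
     supergraph G' G \<and>
     (card (verts G' - verts G) = 1 \<and> edges G' = edges G \<or>
      verts G' = verts G \<and> card (edges G' - edges G) = 1)"

definition adversary_run :: "(nat \<Rightarrow> nat) \<Rightarrow> igraph list \<Rightarrow> bool" where
  "adversary_run p Gs \<longleftrightarrow>
     Gs \<noteq> [] \<and> Gs ! 0 = empty_igraph \<and>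
     (\<forall>i<length Gs. valid_igraph p (Gs ! i)) \<and>
     (\<forall>i. Suc i < length Gs \<longrightarrow> adversary_step (Gs ! i) (Gs ! Suc i))"

definition changed :: "nat \<Rightarrow> igraph \<Rightarrow> igraph \<Rightarrow> nat set" where
  "changed T G G' = {v \<in> verts G'. induced G' (gball G' v T) \<noteq> induced G (gball G v T)}"

text \<open>
  An algorithm maps the number \<open>n\<close> of nodes of the final graph and the history
  \<open>G\<^sub>0, \<dots>, G\<^sub>i\<close> (identifiers included) to the node labeling \<open>L\<^sub>i\<close>. It is correct with
  locality \<open>T\<close>, a function of \<open>n\<close>, if against every adversary all \<open>L\<^sub>i\<close> are feasible and
  labels change only inside \<open>C\<^sub>i\<close>.
\<close>

type_synonym 'out dyn_algorithm = "nat \<Rightarrow> igraph list \<Rightarrow> nat \<Rightarrow> 'out"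

definition dynamic_LOCAL_solves ::
  "(nat \<Rightarrow> nat) \<Rightarrow> (igraph \<Rightarrow> (nat \<Rightarrow> 'out) \<Rightarrow> bool) \<Rightarrow> (nat \<Rightarrow> nat) \<Rightarrow> 'out dyn_algorithm \<Rightarrow> bool" where
  "dynamic_LOCAL_solves p feasible T A \<longleftrightarrow>
     (\<forall>n Gs. adversary_run p Gs \<and> card (verts (last Gs)) = n \<longrightarrow>
        (\<forall>i<length Gs. feasible (Gs ! i) (A n (take (Suc i) Gs))) \<and>
        (\<forall>i. Suc i < length Gs \<longrightarrow>
          (\<forall>v \<in> verts (Gs ! Suc i) - changed (T n) (Gs ! i) (Gs ! Suc i).
             A n (take (Suc (Suc i)) Gs) v = A n (take (Suc i) Gs) v)))"

datatype label = Label (own_id: nat) (nbr_ids: "nat set") (in_labels: "label fset")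

definition acyclic_orientation :: "igraph \<Rightarrow> (nat \<times> nat) set \<Rightarrow> bool" where
  "acyclic_orientation G R \<longleftrightarrow>
     R \<subseteq> adj G \<and>
     (\<forall>u v. {u, v} \<in> edges G \<longrightarrow> ((u, v) \<in> R) \<noteq> ((v, u) \<in> R)) \<and>
     acyclic R"

definition nested_orientation :: "igraph \<Rightarrow> (nat \<times> nat) set \<Rightarrow> (nat \<Rightarrow> label) \<Rightarrow> bool" where
  "nested_orientation G R h \<longleftrightarrow>
     acyclic_orientation G R \<and>
     (\<forall>v\<in>verts G.
        own_id (h v) = ident G v \<and>
        nbr_ids (h v) = ident G ` {u. {v, u} \<in> edges G} \<and>
        fset (in_labels (h v)) = h ` {u. (u, v) \<in> R})"

text \<open>
  A nested orientation as a node labeling: the output of a node consists of the orientations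
  of its incident edges and its label.
\<close>

definition nested_orientation_output ::
  "igraph \<Rightarrow> (nat \<Rightarrow> (nat \<times> nat) set \<times> label) \<Rightarrow> bool" where
  "nested_orientation_output G L \<longleftrightarrow>
     (\<exists>R h. nested_orientation G R h \<and>
        (\<forall>v\<in>verts G. L v = ({(a, b) \<in> R. a = v \<or> b = v}, h v)))"

end

theory Submission
  imports Defs "HOL-Library.Ramsey" "HOL-Library.Infinite_Set"
begin

text \<open>
  The label of a node determines the labels of all its ancestors. Hence if \<open>u\<close> is an ancestor of
  a node \<open>v\<close> at distance more than \<open>T\<close>, attaching an isolated node to \<open>u\<close> changes the label of
  \<open>u\<close> and therefore that of \<open>v\<close>, although the ball of radius \<open>T\<close> around \<open>v\<close> is unchanged.
  It remains to find a graph in which every orientation has such a pair.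
  In the shift graph on the \<open>k\<close>-subsets of \<open>{..<N}\<close>, where \<open>Z - {Max Z}\<close> and \<open>Z - {Min Z}\<close> are
  adjacent for each \<open>(k+1)\<close>-subset \<open>Z\<close>, an orientation is a 2-colouring of the \<open>(k+1)\<close>-subsets.
  Ramsey's theorem yields \<open>2k\<close> points all of whose \<open>(k+1)\<close>-subsets are oriented the same way, and
  so a directed path between the first \<open>k\<close> and the last \<open>k\<close> of them. Since each edge exchanges only
  one element, these disjoint sets are at distance at least \<open>k\<close>.
\<close>

section \<open>Distances and directed paths in shift graphs\<close>

definition shift_edges :: "nat \<Rightarrow> nat \<Rightarrow> nat set set set" where
  "shift_edges k N = (\<lambda>Z. {Z - {Max Z}, Z - {Min Z}}) ` nsets {..<N} (Suc k)"

text \<open>As \<open>k \<ge> 1\<close>, \<open>Z\<close> has at least two elements, so its minimum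
  and maximum differ. Hence an edge is never a loop, and each endpoint has just one element outside
  the other.\<close>

lemma shift_edgesE:
  assumes "{X, Y} \<in> shift_edges k N" "k \<ge> 1"
  shows "X \<in> nsets {..<N} k" "Y \<in> nsets {..<N} k" "X \<noteq> Y" "card (X - Y) \<le> 1"
proof -
  obtain Z where Z: "Z \<in> nsets {..<N} (Suc k)" and e: "{X, Y} = {Z - {Max Z}, Z - {Min Z}}"
    using assms(1) by (auto simp: shift_edges_def)
  have fin: "finite Z" and cZ: "card Z = Suc k" and sub: "Z \<subseteq> {..<N}"
    using Z by (auto simp: nsets_def)
  have ne: "Z \<noteq> {}"
    using cZ by auto
  have mem: "Min Z \<in> Z" "Max Z \<in> Z"
    using fin ne by auto
  have "Min Z \<noteq> Max Z"
  proof
    assume "Min Z = Max Z"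
    then have "Z \<subseteq> {Min Z}"
      using fin Min_le Max_ge by (metis antisym singleton_iff subsetI)
    then have "card Z \<le> 1"
      using card_mono[of "{Min Z}" Z] by simp
    then show False
      using cZ \<open>k \<ge> 1\<close> by simp
  qed
  have XY: "X = Z - {Max Z} \<and> Y = Z - {Min Z} \<or> X = Z - {Min Z} \<and> Y = Z - {Max Z}"
    using e by (auto simp: doubleton_eq_iff)
  then show "X \<in> nsets {..<N} k" "Y \<in> nsets {..<N} k"
    using fin cZ sub mem by (auto simp: nsets_def)
  show "X \<noteq> Y"
    using XY mem \<open>Min Z \<noteq> Max Z\<close> by blast
  have "X - Y \<subseteq> {Min Z} \<or> X - Y \<subseteq> {Max Z}"
    using XY by blast
  then show "card (X - Y) \<le> 1"
    by (metis card_mono finite.emptyI finite_insert is_singletonI is_singleton_altdef)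
qed

text \<open>The size of a set difference obeys a triangle inequality, and each edge of a walk
  contributes at most one. This turns disjointness into distance: no walk of fewer than
  \<open>k\<close> edges joins two disjoint \<open>k\<close>-sets.\<close>

lemma shift_edges_distance:
  assumes "(X, Y) \<in> {(X, Y). {X, Y} \<in> shift_edges k N} ^^ j" "k \<ge> 1"
  shows "card (X - Y) \<le> j"
  using assms(1)
proof (induction j arbitrary: Y)
  case 0
  then show ?case by simp
next
  case (Suc j)
  then obtain W where W: "(X, W) \<in> {(X, Y). {X, Y} \<in> shift_edges k N} ^^ j"
    and e: "{W, Y} \<in> shift_edges k N"
    by auto
  \<comment> \<open>Infinite sets have \<open>card\<close> 0, so \<open>card_mono\<close> needs
    finiteness. \<open>X\<close> is either \<open>W\<close> itself or an endpoint of the first edge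
    of the walk.\<close>
  have fin: "finite (X - W)" "finite (W - Y)"
  proof -
    show "finite (W - Y)"
      using shift_edgesE(1)[OF e \<open>k \<ge> 1\<close>] by (auto simp: nsets_def)
    have "finite W"
      using shift_edgesE(1)[OF e \<open>k \<ge> 1\<close>] by (auto simp: nsets_def)
    have "finite X"
    proof (cases j)
      case 0
      then show ?thesis using W \<open>finite W\<close> by simp
    next
      case (Suc i)
      then obtain V where "{X, V} \<in> shift_edges k N"
        using W relpow_Suc_D2[of X W i] by auto
      then show ?thesis
        using shift_edgesE(1)[OF _ \<open>k \<ge> 1\<close>] by (auto simp: nsets_def)
    qed
    then show "finite (X - W)" by simp
  qed
  have "card (X - Y) \<le> card ((X - W) \<union> (W - Y))"
    using fin by (intro card_mono) auto
  also have "\<dots> \<le> card (X - W) + card (W - Y)"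
    by (rule card_Un_le)
  also have "\<dots> \<le> j + 1"
    using Suc.IH[OF W] shift_edgesE(4)[OF e \<open>k \<ge> 1\<close>] by (rule add_mono)
  finally show ?case by simp
qed

text \<open>\<open>N\<close> depends on \<open>k\<close> only, so a single graph serves every
  orientation. Consecutive windows of \<open>k\<close> points in the homogeneous set are adjacent,
  and equal colours chain these edges into a directed path.\<close>

lemma shift_graph_directed_path:
  assumes "k \<ge> 1"
  obtains N where "\<And>R. (\<And>X Y. {X, Y} \<in> shift_edges k N \<Longrightarrow> (X, Y) \<in> R \<or> (Y, X) \<in> R) \<Longrightarrow>
    \<exists>X\<in>nsets {..<N} k. \<exists>Y\<in>nsets {..<N} k. X \<inter> Y = {} \<and> (X, Y) \<in> R\<^sup>*"
proof -
  obtain N :: nat where N: "partn_lst {..<N} [2 * k, 2 * k] (Suc k)"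
    using ramsey_full by blast
  show thesis
  proof (rule that[of N])
    fix R assume R: "\<And>X Y. {X, Y} \<in> shift_edges k N \<Longrightarrow> (X, Y) \<in> R \<or> (Y, X) \<in> R"
    \<comment> \<open>Colour 0 says that the edge of \<open>Z\<close> leads from the lower window to
      the upper one; by the hypothesis on \<open>R\<close>, colour 1 on a
      \<open>Suc k\<close>-subset of \<open>{..<N}\<close> guarantees the opposite
      direction.\<close>
    define c :: "nat set \<Rightarrow> nat" where
      "c Z = (if (Z - {Max Z}, Z - {Min Z}) \<in> R then 0 else 1)" for Z
    have "c \<in> nsets {..<N} (Suc k) \<rightarrow> {..<2}"
      by (auto simp: c_def)
    then obtain i H where i: "i < length [2 * k, 2 * k]" and H: "H \<in> nsets {..<N} ([2 * k, 2 * k] ! i)"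
      and hom: "c ` nsets H (Suc k) \<subseteq> {i}"
      using N by (rule_tac partn_lstE[OF N, of c 2]) auto
    have "card H = 2 * k" and fH: "finite H" and HN: "H \<subseteq> {..<N}"
      using H i by (auto simp: nsets_def less_Suc_eq)
    then obtain h where bij: "bij_betw h {..<2 * k} H" and mono: "strict_mono_on {..<2 * k} h"
      using ex_bij_betw_strict_mono_card[OF fH] by metis
    have inj: "inj_on h {..<2 * k}" and hH: "h ` {..<2 * k} = H"
      using bij by (auto simp: bij_betw_def)
    \<comment> \<open>The window of \<open>k\<close> consecutive points of \<open>H\<close> from
      index \<open>a\<close> on; it fits into the \<open>2 * k\<close> points as long as
      \<open>a \<le> k\<close>. The points with indices \<open>a\<close> to \<open>a + k\<close>
      form the set \<open>Z\<close> whose edge joins \<open>X a\<close> and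
      \<open>X (Suc a)\<close>.\<close>
    define X where "X a = h ` {a..<a + k}" for a
    have Xn: "X a \<in> nsets {..<N} k" if "a \<le> k" for a
    proof -
      have sub: "{a..<a + k} \<subseteq> {..<2 * k}"
        using that by auto
      have "card (X a) = k"
        unfolding X_def using card_image[OF inj_on_subset[OF inj sub]] by simp
      moreover have "X a \<subseteq> {..<N}"
        unfolding X_def using image_mono[OF sub, of h] hH HN by blast
      ultimately show ?thesis
        by (simp add: nsets_def X_def)
    qed
    have step: "(if i = 0 then (X a, X (Suc a)) else (X (Suc a), X a)) \<in> R" if "a < k" for a
    proof -
      define Z where "Z = h ` {a..a + k}"
      have sub: "{a..a + k} \<subseteq> {..<2 * k}"
        using that by auto
      have inj': "inj_on h {a..a + k}"
        by (rule inj_on_subset[OF inj sub])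
      have ZH: "Z \<in> nsets H (Suc k)"
        unfolding Z_def nsets_def using card_image[OF inj'] image_mono[OF sub, of h] hH by auto
      have le: "h x \<le> h y" if "x \<in> {a..a + k}" "y \<in> {a..a + k}" "x \<le> y" for x y
        using that sub strict_mono_onD[OF mono, of x y] by (cases "x = y") (auto simp: subset_iff)
      have "Min Z = h a" "Max Z = h (a + k)"
        unfolding Z_def by (auto intro!: Min_eqI Max_eqI le)
      moreover have "Z - {h a} = X (Suc a)"
      proof -
        have "{a..a + k} - {a} = {Suc a..<Suc a + k}" by auto
        then show ?thesis
          unfolding Z_def X_def using inj_on_image_set_diff[OF inj', of "{a..a + k}" "{a}"] by auto
      qed
      moreover have "Z - {h (a + k)} = X a"
      proof -
        have "{a..a + k} - {a + k} = {a..<a + k}" by auto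
        then show ?thesis
          unfolding Z_def X_def using inj_on_image_set_diff[OF inj', of "{a..a + k}" "{a + k}"] by auto
      qed
      ultimately have Z: "Z - {Max Z} = X a" "Z - {Min Z} = X (Suc a)"
        by auto
      have "{X a, X (Suc a)} \<in> shift_edges k N"
        unfolding shift_edges_def using ZH nsets_mono[OF HN] Z by (intro image_eqI[of _ _ Z]) auto
      then have "(X a, X (Suc a)) \<in> R \<or> (X (Suc a), X a) \<in> R"
        by (rule R)
      moreover have "c Z = i"
        using hom ZH by blast
      ultimately show ?thesis
        using Z by (auto simp: c_def split: if_splits)
    qed
    \<comment> \<open>Colour 1 yields a path from the last window to the first instead; the claim is
      indifferent to which of the two comes first.\<close>
    have path: "(if i = 0 then (X 0, X a) else (X a, X 0)) \<in> R\<^sup>*" if "a \<le> k" for a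
      using that
    proof (induction a)
      case (Suc a)
      then show ?case
        using step[of a]
        by (auto split: if_splits intro: rtrancl_into_rtrancl converse_rtrancl_into_rtrancl)
    qed simp
    have disj: "X 0 \<inter> X k = {}"
      unfolding X_def using inj_onD[OF inj] by fastforce
    show "\<exists>X\<in>nsets {..<N} k. \<exists>Y\<in>nsets {..<N} k. X \<inter> Y = {} \<and> (X, Y) \<in> R\<^sup>*"
      using path[of k] Xn[of 0] Xn[of k] disj by (cases "i = 0") (auto simp: Int_commute)
  qed
qed

section \<open>Transport of the shift graph to numbered nodes\<close>

lemma exists_graph_with_distant_ancestor:
  assumes "k \<ge> 1"
  obtains m :: nat and E :: "nat set set" where "E \<subseteq> nsets {..<m} 2"
    "\<And>R. (\<And>u v. {u, v} \<in> E \<Longrightarrow> (u, v) \<in> R \<or> (v, u) \<in> R) \<Longrightarrow>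
       \<exists>u<m. \<exists>v<m. (u, v) \<in> R\<^sup>* \<and> (\<forall>j<k. (v, u) \<notin> {(a, b). {a, b} \<in> E} ^^ j)"
proof -
  obtain N where N: "\<And>R. (\<And>X Y. {X, Y} \<in> shift_edges k N \<Longrightarrow> (X, Y) \<in> R \<or> (Y, X) \<in> R) \<Longrightarrow>
    \<exists>X\<in>nsets {..<N} k. \<exists>Y\<in>nsets {..<N} k. X \<inter> Y = {} \<and> (X, Y) \<in> R\<^sup>*"
    using shift_graph_directed_path[OF assms] by blast
  define V where "V = nsets {..<N} k"
  have "finite V"
    by (simp add: V_def finite_imp_finite_nsets)
  then obtain f where "bij_betw f V {0..<card V}"
    using ex_bij_betw_finite_nat by blast
  then have inj: "inj_on f V" and fV: "f ` V = {..<card V}"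
    by (auto simp: bij_betw_def)
  define E where "E = (`) f ` shift_edges k N"
  have edge_sub: "e \<subseteq> V" "card e = 2" if "e \<in> shift_edges k N" for e
  proof -
    obtain X Y where e: "e = {X, Y}"
      using \<open>e \<in> shift_edges k N\<close> by (auto simp: shift_edges_def)
    show "e \<subseteq> V" "card e = 2"
      using shift_edgesE[of X Y k N] that assms by (auto simp: e V_def)
  qed
  have edge_iff: "{f X, f Y} \<in> E \<longleftrightarrow> {X, Y} \<in> shift_edges k N" if "X \<in> V" "Y \<in> V" for X Y
  proof
    assume "{f X, f Y} \<in> E"
    then obtain e where e: "e \<in> shift_edges k N" "f ` {X, Y} = f ` e"
      by (auto simp: E_def)
    then have "{X, Y} = e"
      using inj_on_image_eq_iff[OF inj, of "{X, Y}" e] that edge_sub by auto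
    then show "{X, Y} \<in> shift_edges k N"
      using e by simp
  next
    assume "{X, Y} \<in> shift_edges k N"
    then show "{f X, f Y} \<in> E"
      by (auto simp: E_def image_iff intro!: bexI[of _ "{X, Y}"])
  qed
  have edge_verts: "a \<in> f ` V \<and> b \<in> f ` V" if "{a, b} \<in> E" for a b
  proof -
    obtain e where "e \<in> shift_edges k N" "{a, b} = f ` e"
      using \<open>{a, b} \<in> E\<close> by (auto simp: E_def)
    then show ?thesis
      using edge_sub(1) by blast
  qed
  \<comment> \<open>Every node on an edge of \<open>E\<close> is an image under \<open>f\<close>, so
    a walk between images pulls back step by step.\<close>
  have walk: "(X, Y) \<in> {(X, Y). {X, Y} \<in> shift_edges k N} ^^ j"
    if "(f X, f Y) \<in> {(a, b). {a, b} \<in> E} ^^ j" "X \<in> V" "Y \<in> V" for X Y j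
    using that
  proof (induction j arbitrary: Y)
    case 0
    then show ?case
      using inj by (auto dest: inj_onD)
  next
    case (Suc j)
    then obtain b where b: "(f X, b) \<in> {(a, b). {a, b} \<in> E} ^^ j" "{b, f Y} \<in> E"
      by auto
    obtain W where "b = f W" "W \<in> V"
      using edge_verts[OF b(2)] by auto
    then show ?case
      using b Suc edge_iff by auto
  qed
  show thesis
  proof (rule that[of E "card V"])
    show "E \<subseteq> nsets {..<card V} 2"
    proof
      fix e' assume "e' \<in> E"
      then obtain e where e: "e \<in> shift_edges k N" "e' = f ` e"
        by (auto simp: E_def)
      have "card e' = 2"
        using card_image[OF inj_on_subset[OF inj edge_sub(1)[OF e(1)]]] edge_sub(2)[OF e(1)] e(2)
        by simp
      moreover have "e' \<subseteq> {..<card V}"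
        using edge_sub(1)[OF e(1)] fV e(2) by blast
      ultimately show "e' \<in> nsets {..<card V} 2"
        by (auto simp: nsets_def intro: card_ge_0_finite)
    qed
    fix R assume R: "\<And>u v. {u, v} \<in> E \<Longrightarrow> (u, v) \<in> R \<or> (v, u) \<in> R"
    define R' where "R' = {(X, Y). (f X, f Y) \<in> R}"
    have "(X, Y) \<in> R' \<or> (Y, X) \<in> R'" if "{X, Y} \<in> shift_edges k N" for X Y
      using R edge_iff[of X Y] edge_sub(1)[OF that] that by (auto simp: R'_def)
    then obtain X Y where XY: "X \<in> V" "Y \<in> V" "X \<inter> Y = {}" "(X, Y) \<in> R'\<^sup>*"
      using N[of R'] unfolding V_def by blast
    have "(f X, f Y) \<in> R\<^sup>*"
      using XY(4) by induction (auto simp: R'_def intro: rtrancl_into_rtrancl)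
    moreover have "(f Y, f X) \<notin> {(a, b). {a, b} \<in> E} ^^ j" if "j < k" for j
    proof
      assume "(f Y, f X) \<in> {(a, b). {a, b} \<in> E} ^^ j"
      then have "card (Y - X) \<le> j"
        using walk shift_edges_distance assms XY by blast
      moreover have "Y - X = Y"
        using XY(3) by blast
      moreover have "card Y = k"
        using XY(2) by (auto simp: V_def nsets_def)
      ultimately show False
        using that by simp
    qed
    ultimately show "\<exists>u<card V. \<exists>v<card V. (u, v) \<in> R\<^sup>* \<and>
        (\<forall>j<k. (v, u) \<notin> {(a, b). {a, b} \<in> E} ^^ j)"
      using XY fV by blast
  qed
qed

section \<open>Adversary runs\<close>

text \<open>With identifier \<open>Suc v\<close> at node \<open>v\<close>, a graph on
  \<open>n\<close> nodes uses exactly 1 to \<open>n\<close>, which \<open>n \<le> p n\<close> admits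
  at every stage of a run. \<open>restrict\<close> provides the required extensionality.\<close>

definition std_graph :: "nat \<Rightarrow> nat set set \<Rightarrow> igraph" where
  "std_graph n E = \<lparr>verts = {..<n}, edges = E, ident = restrict Suc {..<n}\<rparr>"

lemma valid_std_graph:
  assumes "\<forall>n. n \<le> p n" "E \<subseteq> nsets {..<n} 2"
  shows "valid_igraph p (std_graph n E)"
  using assms(2) order_trans[OF _ assms(1)[rule_format, of n]]
  by (fastforce simp: valid_igraph_def std_graph_def nsets_def PiE_def Pi_def inj_on_def)

lemma adversary_run_snoc:
  assumes "adversary_run p Gs" "valid_igraph p G" "adversary_step (last Gs) G"
  shows "adversary_run p (Gs @ [G])"
proof -
  have "Gs \<noteq> []"
    using assms(1) by (simp add: adversary_run_def)
  then have "adversary_step (Gs ! i) G" if "Suc i = length Gs" for i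
    using assms(3) last_conv_nth[of Gs] that[symmetric] by simp
  then show ?thesis
    using assms(1,2) by (auto simp: adversary_run_def nth_append less_Suc_eq)
qed

lemma adversary_step_add_edge:
  assumes "e \<notin> E"
  shows "adversary_step (std_graph n E) (std_graph n (insert e E))"
proof -
  have "insert e E - E = {e}"
    using assms by auto
  then show ?thesis
    by (auto simp: adversary_step_def supergraph_def std_graph_def)
qed

lemma adversary_step_add_node: "adversary_step (std_graph n {}) (std_graph (Suc n) {})"
proof -
  have "{..<Suc n} - {..<n} = {n}" by auto
  then show ?thesis
    by (auto simp: adversary_step_def supergraph_def std_graph_def)
qed

text \<open>All nodes are inserted before any edge, so every intermediate graph is again a
  \<open>std_graph\<close> and hence valid.\<close>

lemma exists_run_to_std_graph:
  assumes p: "\<forall>n. n \<le> p n" and E: "E \<subseteq> nsets {..<n} 2"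
  shows "\<exists>Gs. adversary_run p Gs \<and> last Gs = std_graph n E"
proof -
  have nodes: "\<exists>Gs. adversary_run p Gs \<and> last Gs = std_graph n {}"
  proof (induction n)
    case 0
    have "std_graph 0 {} = empty_igraph"
      by (auto simp: std_graph_def empty_igraph_def)
    then have "adversary_run p [std_graph 0 {}]"
      using valid_std_graph[OF p, of "{}" 0] by (simp add: adversary_run_def)
    then show ?case
      by (intro exI[of _ "[std_graph 0 {}]"]) simp
  next
    case (Suc n)
    then obtain Gs where "adversary_run p Gs" "last Gs = std_graph n {}"
      by blast
    then have "adversary_run p (Gs @ [std_graph (Suc n) {}])"
      using valid_std_graph[OF p, of "{}"] adversary_step_add_node
      by (intro adversary_run_snoc) auto
    then show ?case
      by (intro exI[of _ "Gs @ [std_graph (Suc n) {}]"]) simp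
  qed
  have "finite E"
    using E finite_imp_finite_nsets[of "{..<n}" 2] finite_subset by blast
  then show ?thesis
    using E
  proof (induction E)
    case empty
    show ?case by (rule nodes)
  next
    case (insert e E)
    then obtain Gs where "adversary_run p Gs" "last Gs = std_graph n E"
      by auto
    then have "adversary_run p (Gs @ [std_graph n (insert e E)])"
      using valid_std_graph[OF p] adversary_step_add_edge insert
      by (intro adversary_run_snoc) auto
    then show ?case
      by (intro exI[of _ "Gs @ [std_graph n (insert e E)]"]) simp
  qed
qed

section \<open>Locality against propagation of labels\<close>

lemma unchanged_far_from_new_edge:
  assumes v: "v \<in> verts G" and far: "u \<notin> gball G v T" "w \<notin> gball G v T"
    and valid: "\<forall>e\<in>edges G. e \<subseteq> verts G"
    and G': "verts G' = verts G" "edges G' = insert {u, w} (edges G)" "ident G' = ident G"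
  shows "v \<notin> changed T G G'"
proof -
  have walk_mem: "x \<in> verts G" if "(v, x) \<in> adj G ^^ j" for x j
    using that v valid by (cases j) (auto simp: adj_def)
  have "(v, x) \<in> adj G ^^ j" if "(v, x) \<in> adj G' ^^ j" "j \<le> T" for x j
    using that
  proof (induction j arbitrary: x)
    case (Suc j)
    then obtain y where y: "(v, y) \<in> adj G ^^ j" "(y, x) \<in> adj G'"
      by auto
    \<comment> \<open>\<open>y\<close> is reached by an old walk of length \<open>j < T\<close>, so
      it is neither \<open>u\<close> nor \<open>w\<close>, and the step from \<open>y\<close> uses
      an old edge.\<close>
    then have "y \<in> gball G v T"
      using walk_mem Suc.prems by (auto simp: gball_def intro!: exI[of _ j])
    then have "(y, x) \<in> adj G"
      using y(2) far G' by (auto simp: adj_def doubleton_eq_iff)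
    then show ?case
      using y by auto
  qed simp
  moreover have "(v, x) \<in> adj G' ^^ j" if "(v, x) \<in> adj G ^^ j" for x j
    using that
  proof (induction j arbitrary: x)
    case (Suc j)
    then show ?case
      using G' by (auto simp: adj_def)
  qed simp
  ultimately have ball: "gball G' v T = gball G v T"
    using G' by (auto simp: gball_def)
  have "induced G' (gball G v T) = induced G (gball G v T)"
    using G' far by (auto simp: induced_def)
  then show ?thesis
    by (simp add: changed_def ball)
qed

text \<open>Induction backwards along the path from \<open>v\<close>. \<open>R'\<close> need not
  agree with \<open>R\<close>: equality of the labels at \<open>v\<close> alone forces it at all
  ancestors.\<close>

lemma ancestor_label_unchanged:
  assumes "nested_orientation G R h" "nested_orientation G' R' h'"
    and G': "verts G' = verts G" "ident G' = ident G" and inj: "inj_on (ident G) (verts G)"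
    and R: "R \<subseteq> verts G \<times> verts G" and R': "R' \<subseteq> verts G \<times> verts G"
    and anc: "(u, v) \<in> R\<^sup>*" and v: "v \<in> verts G" "h' v = h v"
  shows "h' u = h u"
proof -
  have "u \<in> verts G \<and> h' u = h u"
    using anc
  proof (induction rule: converse_rtrancl_induct)
    case base
    then show ?case using v by simp
  next
    case (step x y)
    then have xy: "x \<in> verts G" "y \<in> verts G" "h' y = h y"
      using R by auto
    have "h x \<in> fset (in_labels (h y))"
      using assms(1) xy step by (auto simp: nested_orientation_def)
    \<comment> \<open>Equal labels at \<open>y\<close> place \<open>h x\<close> among the labels of
      the in-neighbours of \<open>y\<close> under \<open>R'\<close>; the identifier inside it shows
      that the in-neighbour \<open>z\<close> carrying it is \<open>x\<close>.\<close>
    then have "h x \<in> h' ` {z. (z, y) \<in> R'}"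
      using assms(2) xy G' by (auto simp: nested_orientation_def)
    then obtain z where z: "(z, y) \<in> R'" "h x = h' z"
      by blast
    then have "z \<in> verts G"
      using R' by auto
    have "ident G x = own_id (h x)" "ident G z = own_id (h' z)"
      using assms(1,2) xy \<open>z \<in> verts G\<close> G' by (auto simp: nested_orientation_def)
    then have "x = z"
      using z(2) inj_onD[OF inj, of x z] xy(1) \<open>z \<in> verts G\<close> by simp
    then show ?case
      using z xy by simp
  qed
  then show ?thesis by simp
qed

section \<open>The lower bound\<close>

text \<open>The threshold \<open>m\<close> is obtained from \<open>k\<close> alone, so it serves all
  algorithms and locality functions at once. The adversary builds \<open>E\<close> padded with
  isolated nodes, waits for an orientation with a distant ancestor \<open>u\<close> of
  \<open>v\<close>, and then gives \<open>u\<close> a new neighbour.\<close>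

lemma locality_lower_bound:
  assumes p: "\<forall>n. n \<le> p n" and "k \<ge> 1"
  obtains m where "\<And>T A n. dynamic_LOCAL_solves p nested_orientation_output T A \<Longrightarrow> m < n \<Longrightarrow> k \<le> T n"
proof -
  obtain m :: nat and E :: "nat set set" where E: "E \<subseteq> nsets {..<m} 2"
    and anc: "\<And>R. (\<And>u v. {u, v} \<in> E \<Longrightarrow> (u, v) \<in> R \<or> (v, u) \<in> R) \<Longrightarrow>
       \<exists>u<m. \<exists>v<m. (u, v) \<in> R\<^sup>* \<and> (\<forall>j<k. (v, u) \<notin> {(a, b). {a, b} \<in> E} ^^ j)"
    using exists_graph_with_distant_ancestor[OF \<open>k \<ge> 1\<close>] by metis
  have "k \<le> T n" if A: "dynamic_LOCAL_solves p nested_orientation_output T A" and "m < n" for T A n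
  proof (rule ccontr)
    assume "\<not> k \<le> T n"
    define G where "G = std_graph n E"
    have adjG: "adj G = {(a, b). {a, b} \<in> E}"
      by (auto simp: adj_def G_def std_graph_def)
    have vG: "verts G = {..<n}" and eG: "edges G = E" and iG: "ident G = restrict Suc {..<n}"
      by (auto simp: G_def std_graph_def)
    have injG: "inj_on (ident G) (verts G)"
      by (auto simp: vG iG inj_on_def)
    have E': "E \<subseteq> nsets {..<n} 2"
      using E nsets_mono[of "{..<m}" "{..<n}" 2] \<open>m < n\<close> by auto
    obtain Gs where run: "adversary_run p Gs" and last: "last Gs = G"
      using exists_run_to_std_graph[OF p E'] G_def by blast
    have "Gs \<noteq> []"
      using run by (simp add: adversary_run_def)
    define l where "l = length Gs - 1"
    have l: "length Gs = Suc l" "Gs ! l = G"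
      using \<open>Gs \<noteq> []\<close> last by (auto simp: l_def last_conv_nth)
    have feasible: "nested_orientation_output G (A n Gs)"
    proof -
      have "card (verts (last Gs)) = n"
        by (simp add: last vG)
      then have "\<forall>i<length Gs. nested_orientation_output (Gs ! i) (A n (take (Suc i) Gs))"
        using A run unfolding dynamic_LOCAL_solves_def by blast
      then show ?thesis
        using l by force
    qed
    then obtain R h where Rh: "nested_orientation G R h"
      and out: "\<And>x. x \<in> verts G \<Longrightarrow> snd (A n Gs x) = h x"
      unfolding nested_orientation_output_def by auto
    have "(u, v) \<in> R \<or> (v, u) \<in> R" if "{u, v} \<in> E" for u v
      using Rh that eG by (auto simp: nested_orientation_def acyclic_orientation_def)
    then obtain u v where uv: "u < m" "v < m" "(u, v) \<in> R\<^sup>*"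
      and far: "\<And>j. j < k \<Longrightarrow> (v, u) \<notin> adj G ^^ j"
      unfolding adjG using anc[of R] by blast
    \<comment> \<open>\<open>E\<close> lives on the numbers below \<open>m\<close>, so node
      \<open>m\<close>, present because \<open>m < n\<close>, is isolated.\<close>
    have isolated: "{x, m} \<notin> E" "{m, x} \<notin> E" for x
      using E by (auto simp: nsets_def)
    \<comment> \<open>Joining two existing nodes keeps the node count at \<open>n\<close>, so the
      outputs before and after come from the algorithm run with the same \<open>n\<close>.\<close>
    define G' where "G' = std_graph n (insert {u, m} E)"
    have vG': "verts G' = verts G" and eG': "edges G' = insert {u, m} (edges G)"
      and iG': "ident G' = ident G"
      by (auto simp: G'_def G_def std_graph_def)
    have E'': "insert {u, m} E \<subseteq> nsets {..<n} 2"
      using E' uv \<open>m < n\<close> by auto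
    have run': "adversary_run p (Gs @ [G'])"
      using run last adversary_step_add_edge[OF isolated(1)[of u]] valid_std_graph[OF p E'']
      by (intro adversary_run_snoc) (auto simp: G_def G'_def)
    have card': "card (verts (List.last (Gs @ [G']))) = n"
      by (simp add: vG' vG)
    have solved: "(\<forall>i<length (Gs @ [G']). nested_orientation_output ((Gs @ [G']) ! i)
            (A n (take (Suc i) (Gs @ [G'])))) \<and>
        (\<forall>i. Suc i < length (Gs @ [G']) \<longrightarrow>
          (\<forall>v \<in> verts ((Gs @ [G']) ! Suc i) - changed (T n) ((Gs @ [G']) ! i) ((Gs @ [G']) ! Suc i).
             A n (take (Suc (Suc i)) (Gs @ [G'])) v = A n (take (Suc i) (Gs @ [G'])) v))"
      using A run' card' unfolding dynamic_LOCAL_solves_def by blast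
    have feasible': "nested_orientation_output G' (A n (Gs @ [G']))"
      using conjunct1[OF solved, rule_format, of "Suc l"] l by (simp add: nth_append)
    have stable: "A n (Gs @ [G']) x = A n Gs x" if "x \<in> verts G' - changed (T n) G G'" for x
      using conjunct2[OF solved, rule_format, of l x] l that by (simp add: nth_append)
    obtain R' h' where Rh': "nested_orientation G' R' h'"
      and out': "\<And>x. x \<in> verts G' \<Longrightarrow> snd (A n (Gs @ [G']) x) = h' x"
      using feasible' unfolding nested_orientation_output_def by auto
    have "v \<notin> changed (T n) G G'"
    proof (rule unchanged_far_from_new_edge[OF _ _ _ _ vG' eG' iG'])
      show "v \<in> verts G"
        using uv \<open>m < n\<close> vG by auto
      show "u \<notin> gball G v (T n)"
        using far \<open>\<not> k \<le> T n\<close> by (auto simp: gball_def)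
      have "(v, m) \<notin> adj G ^^ j" for j
        using uv isolated by (cases j) (auto simp: adjG)
      then show "m \<notin> gball G v (T n)"
        by (auto simp: gball_def)
      show "\<forall>e\<in>edges G. e \<subseteq> verts G"
        using E' by (auto simp: eG vG nsets_def)
    qed
    then have "h' v = h v"
      using stable[of v] out[of v] out'[of v] uv \<open>m < n\<close> by (auto simp: vG vG')
    moreover have "R \<subseteq> verts G \<times> verts G" "R' \<subseteq> verts G \<times> verts G"
    proof -
      have "adj G \<subseteq> verts G \<times> verts G" "adj G' \<subseteq> verts G \<times> verts G"
        using E'' by (auto simp: adj_def vG eG eG' nsets_def)
      then show "R \<subseteq> verts G \<times> verts G" "R' \<subseteq> verts G \<times> verts G"
        using Rh Rh' by (auto simp: nested_orientation_def acyclic_orientation_def)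
    qed
    moreover have "u \<in> verts G" "v \<in> verts G"
      using uv \<open>m < n\<close> by (auto simp: vG)
    ultimately have "h' u = h u"
      using ancestor_label_unchanged[OF Rh Rh' vG' iG' injG] uv(3) by blast
    \<comment> \<open>The label of \<open>u\<close> also records the identifiers of its neighbours.
      Being unchanged, it would make \<open>m\<close> an old neighbour of \<open>u\<close>.\<close>
    then have "ident G ` {x. {u, x} \<in> edges G'} = ident G ` {x. {u, x} \<in> edges G}"
      using Rh Rh' \<open>u \<in> verts G\<close> vG' iG' unfolding nested_orientation_def by metis
    moreover have "m \<in> {x. {u, x} \<in> edges G'}"
      by (simp add: eG')
    ultimately obtain x where x: "ident G m = ident G x" "{u, x} \<in> E"
      using eG by blast
    then have "x \<in> verts G" "m \<in> verts G"
      using E' \<open>m < n\<close> by (auto simp: vG nsets_def)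
    then have "x = m"
      using x injG by (auto dest: inj_onD)
    then show False
      using x isolated by blast
  qed
  then show thesis
    using that by blast
qed

theorem theoremB3:
  fixes p :: "nat \<Rightarrow> nat"
  assumes "\<exists>c::nat. (\<lambda>n. real (p n)) \<in> O(\<lambda>n. real n ^ c)"
    and "\<forall>n. n \<le> p n"
  shows "(\<forall>T A. dynamic_LOCAL_solves p nested_orientation_output T A \<longrightarrow>
            (\<lambda>n. real (T n)) \<in> \<omega>(\<lambda>_. 1)) \<and>
         \<not> (\<exists>(T :: nat) A. dynamic_LOCAL_solves p nested_orientation_output (\<lambda>_. T) A)"
proof (intro conjI allI impI notI)
  fix T A assume A: "dynamic_LOCAL_solves p nested_orientation_output T A"
  show "(\<lambda>n. real (T n)) \<in> \<omega>(\<lambda>_. 1)"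
  proof (rule landau_omega.smallI)
    fix c :: real
    \<comment> \<open>\<open>\<omega>(1)\<close> asks that \<open>T\<close> eventually exceed each
      constant \<open>c\<close>; the threshold for a natural number above \<open>c\<close> supplies
      this.\<close>
    obtain k :: nat where k: "c \<le> real k"
      using real_arch_simple by blast
    obtain m where m: "\<And>n. m < n \<Longrightarrow> Suc k \<le> T n"
      using locality_lower_bound[OF assms(2), of "Suc k"] A by (metis le_add1 plus_1_eq_Suc)
    have "c * norm (1 :: real) \<le> norm (real (T n))" if "m < n" for n
      using k m[OF that] by simp
    then show "\<forall>\<^sub>F n in at_top. c * norm (1 :: real) \<le> norm (real (T n))"
      by (rule eventually_mono[OF eventually_gt_at_top])
  qed
next
  assume "\<exists>(T :: nat) A. dynamic_LOCAL_solves p nested_orientation_output (\<lambda>_. T) A"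
  then obtain T :: nat and A where "dynamic_LOCAL_solves p nested_orientation_output (\<lambda>_. T) A"
    by blast
  \<comment> \<open>A constant locality \<open>T\<close> already fails the bound
    \<open>Suc T\<close> at a single \<open>n\<close> above the threshold.\<close>
  moreover obtain m where "\<And>T' A n. dynamic_LOCAL_solves p nested_orientation_output T' A \<Longrightarrow>
      m < n \<Longrightarrow> Suc T \<le> T' n"
    using locality_lower_bound[OF assms(2), of "Suc T"] by auto
  ultimately have "Suc T \<le> T"
    by (meson lessI)
  then show False by simp
qed

end
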